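(* $\mathtt{Cofinite}<_{LT}\mathtt{DenError}_0$.
   Context: A bilayer function is a partial multi-valued function $g\colon\subseteq\mathbb{N}\times\Lambda\rightrightarrows\mathbb{N}$ for some set $\Lambda$; arguments are written $(n\mid c)$ ($n$ public, $c$ secret input); $\mathrm{dom}_{\rm pub}(g)=\{n:\exists c\,(n\mid c)\in\mathrm{dom}(g)\}$. $\mathtt{Cofinite}$ has public input $\ast$, secret inputs $n\in\mathbb{N}$, and $\mathtt{Cofinite}(\ast\mid n)=\{m\in\mathbb{N}:m\ge n\}$. For real $\varepsilon\in[0,1]$, $\mathtt{DenError}_\varepsilon$ has public input $\ast$, $\mathrm{dom}=\{(\ast\mid A):A\subseteq\mathbb{N},\ \underline{d}(A)\ge1-\varepsilon\}$ where $\underline{d}(A)=\liminf_{n\to\infty}|A\cap\{0,\dots,n-1\}|/n$, and $\mathtt{DenError}_\varepsilon(\ast\mid A)=A$. LT-reducibility: in the game $\mathfrak{G}(f,g)$ Merlin first plays $(x_0\mid c_0)\in\mathrm{dom}(f)$; at round $n$ Arthur plays $\langle j,u_n\rangle$ ($j=0$: query $u_n\in\mathrm{dom}_{\rm pub}(g)$; $j=1$: terminate with output $u_n$); after a query Nimue plays $z_n$ with $(u_n\mid z_n)\in\mathrm{dom}(g)$ and Merlin plays $x_{n+1}\in g(u_n\mid z_n)$. Arthur sees only $x_0,x_1,\dots$ and plays by a partial computable strategy; Merlin and Nimue see everything. Arthur and Nimue win if Merlin violates the rules first or both obey and Arthur terminates with $u_n\in f(x_0\mid c_0)$. $f\le_{LT}g$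 iff a winning Arthur–Nimue strategy exists; $f<_{LT}g$ iff $f\le_{LT}g$ and not $g\le_{LT}f$. *)

theory Defs
  imports Complex_Main "HOL-Library.Extended_Real" "HOL-Library.Nat_Bijection"
begin

text \<open>Partial recursive functions. A function lives on argument lists of every length; restricted
  to lists of a fixed length \<open>k\<close>, the closure below yields exactly the partial recursive functions
  of arity \<open>k\<close>. The value \<open>None\<close> means divergence.\<close>

primrec prim_rec :: "(nat list \<rightharpoonup> nat) \<Rightarrow> (nat list \<rightharpoonup> nat) \<Rightarrow> nat \<Rightarrow> nat list \<rightharpoonup> nat" where
  "prim_rec f g 0 xs = f xs"
| "prim_rec f g (Suc n) xs = Option.bind (prim_rec f g n xs) (\<lambda>r. g (n # r # xs))"

definition minimize :: "(nat list \<rightharpoonup> nat) \<Rightarrow> nat list \<rightharpoonup> nat" where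
  "minimize f xs =
    (if \<exists>y. f (y # xs) = Some 0 \<and> (\<forall>z<y. \<exists>v. f (z # xs) = Some (Suc v))
     then Some (LEAST y. f (y # xs) = Some 0) else None)"

inductive partial_recursive :: "(nat list \<rightharpoonup> nat) \<Rightarrow> bool" where
  zero: "partial_recursive (\<lambda>xs. Some 0)"
| succ: "partial_recursive (\<lambda>xs. case xs of [] \<Rightarrow> None | x # _ \<Rightarrow> Some (Suc x))"
| proj: "partial_recursive (\<lambda>xs. if i < length xs then Some (xs ! i) else None)"
| comp: "partial_recursive f \<Longrightarrow> (\<And>g. g \<in> set gs \<Longrightarrow> partial_recursive g) \<Longrightarrow>
    partial_recursive (\<lambda>xs. if \<forall>g\<in>set gs. g xs \<noteq> None
                            then f (map (\<lambda>g. the (g xs)) gs) else None)"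
| prec: "partial_recursive f \<Longrightarrow> partial_recursive g \<Longrightarrow>
    partial_recursive (\<lambda>xs. case xs of [] \<Rightarrow> None | n # ys \<Rightarrow> prim_rec f g n ys)"
| mini: "partial_recursive f \<Longrightarrow> partial_recursive (minimize f)"

text \<open>Computability of a partial function on finite sequences, via their codes.\<close>

definition partial_computable :: "(nat list \<rightharpoonup> nat) \<Rightarrow> bool" where
  "partial_computable \<tau> \<longleftrightarrow>
    (\<exists>F. partial_recursive F \<and> (\<forall>xs. \<tau> xs = F [list_encode xs]))"

text \<open>A bilayer function is a partial function into the power set; a point of the domain may have
  the empty set as its value. The set of secret inputs is a type, cut down by the domain.\<close>

type_synonym 'l bilayer = "nat \<times> 'l \<rightharpoonup> nat set"

definition dom_pub :: "'l bilayer \<Rightarrow> nat set" where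
  "dom_pub g = {n. \<exists>c. (n, c) \<in> dom g}"

text \<open>A play of the game for \<open>f :: 'l bilayer\<close> and \<open>g :: 'm bilayer\<close>. Everything after the end of
  the game (termination by Arthur or the first violation of a rule) is irrelevant padding. The
  value \<open>None\<close> for Arthur's move means that he never answers.\<close>

record ('l, 'm) play =
  secret :: 'l
  merlin :: "nat \<Rightarrow> nat"
  arthur :: "nat \<Rightarrow> nat option"
  nimue :: "nat \<Rightarrow> 'm"

definition queries :: "('l, 'm) play \<Rightarrow> nat \<Rightarrow> nat \<Rightarrow> bool" where
  "queries p n u \<longleftrightarrow> arthur p n = Some (prod_encode (0, u))"

definition terminates :: "('l, 'm) play \<Rightarrow> nat \<Rightarrow> nat \<Rightarrow> bool" where
  "terminates p n u \<longleftrightarrow> arthur p n = Some (prod_encode (1, u))"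

fun merlin_legal :: "'l bilayer \<Rightarrow> 'm bilayer \<Rightarrow> ('l, 'm) play \<Rightarrow> nat \<Rightarrow> bool" where
  "merlin_legal f g p 0 \<longleftrightarrow> (merlin p 0, secret p) \<in> dom f"
| "merlin_legal f g p (Suc n) \<longleftrightarrow>
    (\<exists>u V. queries p n u \<and> g (u, nimue p n) = Some V \<and> merlin p (Suc n) \<in> V)"

definition arthur_legal_query :: "'m bilayer \<Rightarrow> ('l, 'm) play \<Rightarrow> nat \<Rightarrow> bool" where
  "arthur_legal_query g p n \<longleftrightarrow> (\<exists>u. queries p n u \<and> u \<in> dom_pub g)"

definition nimue_legal :: "'m bilayer \<Rightarrow> ('l, 'm) play \<Rightarrow> nat \<Rightarrow> bool" where
  "nimue_legal g p n \<longleftrightarrow> (\<exists>u. queries p n u \<and> (u, nimue p n) \<in> dom g)"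

text \<open>The moves are made in the order Merlin, Arthur, Nimue within each round. Round \<open>n\<close> is reached
  when all earlier rounds were completed legally without termination. Infinite plays are lost by
  Arthur and Nimue.\<close>

definition reaches :: "'l bilayer \<Rightarrow> 'm bilayer \<Rightarrow> ('l, 'm) play \<Rightarrow> nat \<Rightarrow> bool" where
  "reaches f g p n \<longleftrightarrow>
    (\<forall>k<n. merlin_legal f g p k \<and> arthur_legal_query g p k \<and> nimue_legal g p k)"

definition arthur_nimue_win :: "'l bilayer \<Rightarrow> 'm bilayer \<Rightarrow> ('l, 'm) play \<Rightarrow> bool" where
  "arthur_nimue_win f g p \<longleftrightarrow>
    (\<exists>n. reaches f g p n \<and>
      (\<not> merlin_legal f g p n \<or>
       (\<exists>u V. terminates p n u \<and> f (merlin p 0, secret p) = Some V \<and> u \<in> V)))"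

text \<open>Arthur sees \<open>x\<^sub>0, \<dots>, x\<^sub>n\<close> only; Nimue sees the secret input and all moves made so far, in the
  order of the arguments: Merlin's, Arthur's and her own.\<close>

type_synonym arthur_strategy = "nat list \<rightharpoonup> nat"
type_synonym ('l, 'm) nimue_strategy =
  "'l \<Rightarrow> nat list \<Rightarrow> nat option list \<Rightarrow> 'm list \<Rightarrow> 'm"

definition follows ::
  "arthur_strategy \<Rightarrow> ('l, 'm) nimue_strategy \<Rightarrow> ('l, 'm) play \<Rightarrow> bool" where
  "follows \<tau> \<eta> p \<longleftrightarrow>
    (\<forall>n. arthur p n = \<tau> (map (merlin p) [0..<Suc n]) \<and>
         nimue p n = \<eta> (secret p) (map (merlin p) [0..<Suc n])
                       (map (arthur p) [0..<Suc n]) (map (nimue p) [0..<n]))"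

definition LT_reducible :: "'l bilayer \<Rightarrow> 'm bilayer \<Rightarrow> bool" (infix "\<le>\<^sub>L\<^sub>T" 50) where
  "f \<le>\<^sub>L\<^sub>T g \<longleftrightarrow>
    (\<exists>\<tau> \<eta>. partial_computable \<tau> \<and> (\<forall>p. follows \<tau> \<eta> p \<longrightarrow> arthur_nimue_win f g p))"

definition LT_strictly_reducible :: "'l bilayer \<Rightarrow> 'm bilayer \<Rightarrow> bool" (infix "<\<^sub>L\<^sub>T" 50) where
  "f <\<^sub>L\<^sub>T g \<longleftrightarrow> f \<le>\<^sub>L\<^sub>T g \<and> \<not> g \<le>\<^sub>L\<^sub>T f"

text \<open>The dummy public input \<open>\<ast>\<close> is coded by \<open>0\<close>.\<close>

definition Cofinite :: "nat bilayer" where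
  "Cofinite = (\<lambda>(x, n). if x = 0 then Some {m. m \<ge> n} else None)"

definition lower_density :: "nat set \<Rightarrow> ereal" where
  "lower_density A = liminf (\<lambda>n. ereal (real (card (A \<inter> {0..<n})) / real n))"

definition DenError :: "real \<Rightarrow> nat set bilayer" where
  "DenError \<epsilon> =
    (\<lambda>(x, A). if x = 0 \<and> lower_density A \<ge> ereal (1 - \<epsilon>) then Some A else None)"

end

theory Submission
  imports Defs
begin

text \<open>
  For the reduction, Nimue plays the final segment given by the secret input, and any number above
  Merlin's reply is a correct output, for instance a bound computed from the code of the history.

  For the converse, fix Arthur's strategy and let \<open>won \<tau> B\<close> be the set of histories from which Arthur
  and Nimue can force an output outside \<open>B\<close> when they query \<open>Cofinite\<close>. For a fixed history, the sets
  \<open>B\<close> that can be avoided form an ideal. By induction on a history that is won at all, some set of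
  density zero cannot be avoided: choose such a set \<open>B x\<close> for each reply \<open>x\<close> and let \<open>B\<close> be a
  density zero set almost containing each \<open>B x\<close>. If \<open>B\<close> can be avoided, then for almost all \<open>x\<close>
  a single point \<open>u x\<close> of the finite set \<open>B x - B\<close> cannot be avoided; hence neither can an
  infinite density zero set of such points (or the set of all these points, if it is finite). Merlin
  wins by playing the complement of an unavoidable set of density zero.
\<close>

section \<open>Sets of density zero\<close>

definition density_zero :: "nat set \<Rightarrow> bool" where
  "density_zero B \<longleftrightarrow> (\<lambda>n. real (card (B \<inter> {0..<n})) / real n) \<longlonglongrightarrow> 0"

lemma density_zero_bounded:
  assumes "f \<longlonglongrightarrow> 0" "eventually (\<lambda>n. real (card (B \<inter> {0..<n})) / real n \<le> f n) sequentially"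
  shows "density_zero B"
  unfolding density_zero_def
  by (rule tendsto_sandwich[OF _ assms(2) tendsto_const assms(1)]) simp

lemma density_zero_finite:
  assumes "finite B"
  shows "density_zero B"
proof (rule density_zero_bounded)
  show "(\<lambda>n. real (card B) * inverse (real n)) \<longlonglongrightarrow> 0"
    by (rule tendsto_mult_right_zero[OF lim_inverse_n])
  show "eventually (\<lambda>n. real (card (B \<inter> {0..<n})) / real n \<le> real (card B) * inverse (real n))
      sequentially"
    using card_mono[OF assms, of "B \<inter> {0..<_}"]
    by (intro always_eventually allI) (auto simp: divide_inverse intro!: mult_right_mono)
qed

lemma density_zero_Un:
  assumes "density_zero B" "density_zero C"
  shows "density_zero (B \<union> C)"
proof (rule density_zero_bounded)
  show "(\<lambda>n. real (card (B \<inter> {0..<n})) / real n + real (card (C \<inter> {0..<n})) / real n) \<longlonglongrightarrow> 0"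
    using tendsto_add[OF assms[unfolded density_zero_def]] by simp
  have "card ((B \<union> C) \<inter> {0..<n}) \<le> card (B \<inter> {0..<n}) + card (C \<inter> {0..<n})" for n
    by (simp add: Int_Un_distrib2 card_Un_le)
  then have "real (card ((B \<union> C) \<inter> {0..<n})) \<le> real (card (B \<inter> {0..<n})) + real (card (C \<inter> {0..<n}))" for n
    by (metis of_nat_add of_nat_le_iff)
  then show "eventually (\<lambda>n. real (card ((B \<union> C) \<inter> {0..<n})) / real n \<le>
      real (card (B \<inter> {0..<n})) / real n + real (card (C \<inter> {0..<n})) / real n) sequentially"
    by (intro always_eventually allI) (simp add: divide_right_mono flip: add_divide_distrib)
qed

lemma density_zero_UN:
  assumes "finite I" "\<And>i. i \<in> I \<Longrightarrow> density_zero (B i)"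
  shows "density_zero (\<Union>i\<in>I. B i)"
  using assms by (induction I rule: finite_induct) (auto intro: density_zero_Un density_zero_finite)

text \<open>The ideal of density zero sets is a P-ideal, by a diagonal argument: \<open>B x\<close>
  enters \<open>C\<close> only from a threshold \<open>N x\<close> on, beyond which
  \<open>B 0\<close>, ..., \<open>B x\<close> together have relative frequency at most
  1/(x+1).\<close>

lemma density_zero_pseudo_union:
  assumes B: "\<And>x::nat. density_zero (B x)"
  obtains C where "density_zero C" "\<And>x. finite (B x - C)"
proof -
  define d where "d x n = real (card ((\<Union>i\<le>x. B i) \<inter> {0..<n})) / real n" for x n
  have "\<exists>M. \<forall>n\<ge>M. d x n \<le> inverse (real (Suc x))" for x
  proof -
    have "d x \<longlonglongrightarrow> 0"
      using density_zero_UN[of "{..x}" B] B by (simp add: density_zero_def d_def[abs_def])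
    from order_tendstoD(2)[OF this, of "inverse (real (Suc x))"] show ?thesis
      by (auto simp: eventually_sequentially intro: less_imp_le)
  qed
  then obtain M where M: "\<And>x n. n \<ge> M x \<Longrightarrow> d x n \<le> inverse (real (Suc x))"
    by metis
  \<comment> \<open>The sum puts \<open>N x\<close> above \<open>M x\<close>, so the bound on
    \<open>d x\<close> applies from \<open>N x\<close> on. The summand \<open>x\<close> leaves only
    finitely many thresholds below any \<open>n\<close>, so that the maximum \<open>y\<close> below
    exists.\<close>
  define N where "N x = x + (\<Sum>i\<le>x. M i)" for x
  have N_M: "M x \<le> N x" for x
    using member_le_sum[of x "{..x}" M] by (auto simp: N_def intro: trans_le_add2)
  have N_less: "x \<le> N x" for x by (simp add: N_def)
  have N_mono: "N x \<le> N y" if "x \<le> y" for x y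
    using that by (auto simp: N_def intro!: add_mono sum_mono2)
  define C where "C = (\<Union>x. B x - {..<N x})"
  show thesis
  proof
    show "finite (B x - C)" for x
      by (rule finite_subset[of _ "{..<N x}"]) (auto simp: C_def)
    show "density_zero C"
      unfolding density_zero_def
    proof (rule LIMSEQ_I)
      fix r :: real assume "r > 0"
      then obtain k where k: "inverse (real (Suc k)) < r"
        using reals_Archimedean by blast
      have "real (card (C \<inter> {0..<n})) / real n < r" if n: "n \<ge> N k" for n
      proof -
        have fin: "finite {x. N x \<le> n}"
          by (rule finite_subset[of _ "{..n}"]) (auto intro: order_trans[OF N_less])
        define y where "y = Max {x. N x \<le> n}"
        have y: "N y \<le> n" "k \<le> y" and y_max: "\<And>x. N x \<le> n \<Longrightarrow> x \<le> y"
          using Max_in[OF fin] Max_ge[OF fin] n by (auto simp: y_def)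
        \<comment> \<open>An element of \<open>C\<close> below \<open>n\<close> comes from some
          \<open>B x\<close> with \<open>N x\<close> \<le> \<open>n\<close>, hence with
          \<open>x\<close> \<le> \<open>y\<close>.\<close>
        have "C \<inter> {0..<n} \<subseteq> (\<Union>i\<le>y. B i) \<inter> {0..<n}"
          using y_max by (fastforce simp: C_def)
        then have "card (C \<inter> {0..<n}) \<le> card ((\<Union>i\<le>y. B i) \<inter> {0..<n})"
          by (intro card_mono) auto
        then have "real (card (C \<inter> {0..<n})) / real n \<le> d y n"
          by (simp add: d_def divide_right_mono)
        also have "\<dots> \<le> inverse (real (Suc y))"
          using M[of y n] N_M[of y] y(1) by simp
        also have "\<dots> \<le> inverse (real (Suc k))"
          using y(2) by (intro le_imp_inverse_le) auto
        finally show ?thesis using k by simp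
      qed
      then show "\<exists>no. \<forall>n\<ge>no. norm (real (card (C \<inter> {0..<n})) / real n - 0) < r"
        by auto
    qed
  qed
qed

text \<open>Thinning along the squares works: the element of \<open>U\<close> with index k^2 is at
  least k^2, so at most sqrt n + 1 of the chosen elements lie below n.\<close>

lemma infinite_density_zero_subset:
  assumes "infinite (U :: nat set)"
  obtains C where "C \<subseteq> U" "infinite C" "density_zero C"
proof
  let ?s = "\<lambda>k::nat. enumerate U (k^2)"
  show "range ?s \<subseteq> U"
    using enumerate_in_set[OF assms] by blast
  have "inj ?s"
  proof (rule injI)
    fix k l assume "?s k = ?s l"
    then have "k^2 = l^2"
      by (rule injD[OF strict_mono_imp_inj_on[OF strict_mono_enumerate[OF assms]]])
    then show "k = l" by simp
  qed
  then show "infinite (range ?s)"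
    by (simp add: finite_image_iff)
  show "density_zero (range ?s)"
  proof (rule density_zero_bounded)
    have "(\<lambda>n. inverse (sqrt (real n)) + inverse (real n)) \<longlonglongrightarrow> 0 + 0"
      by (intro tendsto_add lim_inverse_n tendsto_inverse_0_at_top
          filterlim_compose[OF sqrt_at_top filterlim_real_sequentially])
    then show "(\<lambda>n. inverse (sqrt (real n)) + inverse (real n)) \<longlonglongrightarrow> 0" by simp
    have "real (card (range ?s \<inter> {0..<n})) / real n \<le> inverse (sqrt (real n)) + inverse (real n)"
      if "n > 0" for n
    proof -
      have "k < Suc (nat \<lfloor>sqrt (real n)\<rfloor>)" if "?s k < n" for k
      proof -
        have "k^2 < n" using le_enumerate[OF assms, of "k^2"] that by simp
        then have "real k \<le> sqrt (real n)"
          by (intro real_le_rsqrt) (metis less_imp_le of_nat_le_iff of_nat_power)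
        then show ?thesis by linarith
      qed
      then have "range ?s \<inter> {0..<n} \<subseteq> ?s ` {..<Suc (nat \<lfloor>sqrt (real n)\<rfloor>)}"
        by auto
      then have "card (range ?s \<inter> {0..<n}) \<le> Suc (nat \<lfloor>sqrt (real n)\<rfloor>)"
        by (metis (no_types, lifting) card_image_le card_lessThan card_mono finite_imageI
            finite_lessThan order_trans)
      then have "real (card (range ?s \<inter> {0..<n})) \<le> sqrt (real n) + 1"
        by (smt (verit) of_nat_Suc of_nat_floor of_nat_le_iff real_sqrt_ge_zero of_nat_0_le_iff)
      then have "real (card (range ?s \<inter> {0..<n})) / real n \<le> (sqrt (real n) + 1) / real n"
        by (simp add: divide_right_mono)
      also have "\<dots> = inverse (sqrt (real n)) + inverse (real n)"
        using \<open>n > 0\<close> by (simp add: field_simps)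
      finally show ?thesis .
    qed
    then show "eventually (\<lambda>n. real (card (range ?s \<inter> {0..<n})) / real n
        \<le> inverse (sqrt (real n)) + inverse (real n)) sequentially"
      by (auto intro: eventually_mono[OF eventually_gt_at_top[of 0]])
  qed
qed

lemma lower_density_Compl:
  assumes "density_zero B"
  shows "lower_density (- B) = 1"
proof -
  have "real (card (- B \<inter> {0..<n})) / real n = 1 - real (card (B \<inter> {0..<n})) / real n"
    if "n > 0" for n
  proof -
    have "card (- B \<inter> {0..<n}) = n - card (B \<inter> {0..<n})"
      using card_Diff_subset_Int[of "{0..<n}" B] by (simp add: Diff_eq Int_commute)
    moreover have "card (B \<inter> {0..<n}) \<le> n"
      using card_mono[of "{0..<n}" "B \<inter> {0..<n}"] by simp
    ultimately show ?thesis using that by (simp add: of_nat_diff field_simps)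
  qed
  then have "eventually (\<lambda>n. 1 - real (card (B \<inter> {0..<n})) / real n =
      real (card (- B \<inter> {0..<n})) / real n) sequentially"
    by (auto intro: eventually_mono[OF eventually_gt_at_top[of 0]])
  moreover have "(\<lambda>n. 1 - real (card (B \<inter> {0..<n})) / real n) \<longlonglongrightarrow> 1"
    using tendsto_diff[OF tendsto_const assms[unfolded density_zero_def], of 1] by simp
  ultimately have "(\<lambda>n. real (card (- B \<inter> {0..<n})) / real n) \<longlonglongrightarrow> 1"
    by (simp add: tendsto_cong)
  then have "(\<lambda>n. ereal (real (card (- B \<inter> {0..<n})) / real n)) \<longlonglongrightarrow> ereal 1"
    by (rule tendsto_ereal)
  then show ?thesis
    unfolding lower_density_def one_ereal_def
    by (rule lim_imp_Liminf[OF sequentially_bot])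
qed

lemma DenError_0_eq_Some:
  "density_zero B \<Longrightarrow> DenError 0 (0, - B) = Some (- B)"
  by (simp add: DenError_def lower_density_Compl one_ereal_def)

section \<open>The reduction of Cofinite to DenError\<close>

lemma partial_recursive_comp1:
  assumes "partial_recursive f" "partial_recursive g"
  obtains h where "partial_recursive h" "\<And>xs y. g xs = Some y \<Longrightarrow> h xs = f [y]"
proof
  show "partial_recursive (\<lambda>xs. if \<forall>g\<in>set [g]. g xs \<noteq> None then f (map (\<lambda>g. the (g xs)) [g]) else None)"
    using assms by (intro comp) auto
qed simp

lemma partial_recursive_comp2:
  assumes "partial_recursive f" "partial_recursive g" "partial_recursive g'"
  obtains h where "partial_recursive h"
    "\<And>xs y z. g xs = Some y \<Longrightarrow> g' xs = Some z \<Longrightarrow> h xs = f [y, z]"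
proof
  show "partial_recursive
      (\<lambda>xs. if \<forall>g\<in>set [g, g']. g xs \<noteq> None then f (map (\<lambda>g. the (g xs)) [g, g']) else None)"
    using assms by (intro comp) auto
qed simp

lemma partial_recursive_nth:
  obtains f where "partial_recursive f" "\<And>xs. i < length xs \<Longrightarrow> f xs = Some (xs ! i)"
  using proj[of i] by simp

lemma partial_recursive_Suc:
  assumes "partial_recursive g"
  obtains h where "partial_recursive h" "\<And>xs y. g xs = Some y \<Longrightarrow> h xs = Some (Suc y)"
  by (rule partial_recursive_comp1[OF succ assms]) (simp add: that)

text \<open>This is the clause \<open>prec\<close> with an empty parameter list. A step that ignores
  \<open>r\<close> turns it into a case distinction between zero and successor.\<close>

lemma partial_recursive_rec_nat:
  assumes "partial_recursive g" "\<And>n r. g [n, r] = Some (h n r)"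
  obtains f where "partial_recursive f" "\<And>n. f [n] = Some (rec_nat 0 h n)"
proof -
  have "prim_rec (\<lambda>_. Some 0) g n [] = Some (rec_nat 0 h n)" for n
    by (induction n) (simp_all add: assms(2))
  then show thesis
    using prec[OF zero assms(1)] that by simp
qed

lemma partial_recursive_add:
  obtains f where "partial_recursive f" "\<And>m n. f [m, n] = Some (m + n)"
proof -
  obtain p where p: "partial_recursive p" "\<And>xs. 0 < length xs \<Longrightarrow> p xs = Some (xs ! 0)"
    using partial_recursive_nth[of 0] by blast
  obtain q where q: "partial_recursive q" "\<And>xs. 1 < length xs \<Longrightarrow> q xs = Some (xs ! 1)"
    using partial_recursive_nth[of 1] by blast
  obtain s where s: "partial_recursive s" "\<And>xs y. q xs = Some y \<Longrightarrow> s xs = Some (Suc y)"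
    using partial_recursive_Suc[OF q(1)] by blast
  have "prim_rec p s m [n] = Some (m + n)" for m n
    by (induction m) (simp_all add: p q s)
  then show thesis
    using prec[OF p(1) s(1)] that by simp
qed

text \<open>Arthur's moves are Cantor pairs, and \<open>prod_encode (m, n)\<close> is
  \<open>triangle (m + n) + m\<close>.\<close>

lemma partial_recursive_triangle:
  obtains f where "partial_recursive f" "\<And>n. f [n] = Some (triangle n)"
proof -
  obtain p where p: "partial_recursive p" "\<And>xs. 0 < length xs \<Longrightarrow> p xs = Some (xs ! 0)"
    using partial_recursive_nth[of 0] by blast
  obtain q where q: "partial_recursive q" "\<And>xs. 1 < length xs \<Longrightarrow> q xs = Some (xs ! 1)"
    using partial_recursive_nth[of 1] by blast
  obtain a where a: "partial_recursive a" "\<And>m n. a [m, n] = Some (m + n)"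
    using partial_recursive_add by blast
  obtain b where b: "partial_recursive b"
    "\<And>xs y z. p xs = Some y \<Longrightarrow> q xs = Some z \<Longrightarrow> b xs = a [y, z]"
    using partial_recursive_comp2[OF a(1) p(1) q(1)] by blast
  obtain c where c: "partial_recursive c" "\<And>xs y. b xs = Some y \<Longrightarrow> c xs = Some (Suc y)"
    using partial_recursive_Suc[OF b(1)] by blast
  have "c [n, r] = Some (Suc (n + r))" for n r
    using b(2)[of "[n, r]" n r] by (intro c(2)) (simp add: a p q)
  then obtain f where f: "partial_recursive f" "\<And>n. f [n] = Some (rec_nat 0 (\<lambda>n r. Suc (n + r)) n)"
    using partial_recursive_rec_nat[OF c(1), of "\<lambda>n r. Suc (n + r)"] by blast
  have "rec_nat 0 (\<lambda>n r. Suc (n + r)) n = triangle n" for n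
    by (induction n) simp_all
  with f that show thesis by simp
qed

section \<open>A computable strategy for Arthur\<close>

text \<open>Merlin's first move is \<open>0\<close>, so \<open>1\<close> is the code of the initial history. Every other history is
  answered by an output bounding its last entry.\<close>

definition code_bound_strategy :: "nat list \<Rightarrow> nat" where
  "code_bound_strategy xs =
    (case list_encode xs of Suc (Suc n) \<Rightarrow> prod_encode (1, Suc n) | _ \<Rightarrow> prod_encode (0, 0))"

lemma partial_computable_code_bound_strategy:
  "partial_computable (\<lambda>xs. Some (code_bound_strategy xs))"
proof -
  obtain p where p: "partial_recursive p" "\<And>xs. 0 < length xs \<Longrightarrow> p xs = Some (xs ! 0)"
    using partial_recursive_nth[of 0] by blast
  obtain s where s: "partial_recursive s" "\<And>xs y. p xs = Some y \<Longrightarrow> s xs = Some (Suc y)"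
    using partial_recursive_Suc[OF p(1)] by blast
  obtain s2 where s2: "partial_recursive s2" "\<And>xs y. s xs = Some y \<Longrightarrow> s2 xs = Some (Suc y)"
    using partial_recursive_Suc[OF s(1)] by blast
  obtain t where t: "partial_recursive t" "\<And>n. t [n] = Some (triangle n)"
    using partial_recursive_triangle by blast
  obtain t2 where t2: "partial_recursive t2" "\<And>xs y. s2 xs = Some y \<Longrightarrow> t2 xs = t [y]"
    using partial_recursive_comp1[OF t(1) s2(1)] by blast
  obtain h where h: "partial_recursive h" "\<And>xs y. t2 xs = Some y \<Longrightarrow> h xs = Some (Suc y)"
    using partial_recursive_Suc[OF t2(1)] by blast
  have "h [n, r] = Some (prod_encode (1, Suc n))" for n r
  proof -
    have "s2 [n, r] = Some (Suc (Suc n))" by (intro s2 s) (simp add: p)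
    then have "h [n, r] = Some (Suc (triangle (Suc (Suc n))))"
      by (intro h(2)) (simp add: t2 t)
    then show ?thesis by (simp add: prod_encode_def)
  qed
  then obtain G where G: "partial_recursive G"
    "\<And>n. G [n] = Some (rec_nat 0 (\<lambda>n r. prod_encode (1, Suc n)) n)"
    using partial_recursive_rec_nat[OF h(1), of "\<lambda>n r. prod_encode (1, Suc n)"] by blast
  obtain G2 where G2: "partial_recursive G2" "\<And>xs y. p xs = Some y \<Longrightarrow> G2 xs = G [y]"
    using partial_recursive_comp1[OF G(1) p(1)] by blast
  have "G2 [n, r] = Some (rec_nat 0 (\<lambda>n r. prod_encode (1, Suc n)) n)" for n r
    using G2(2)[of "[n, r]" n] by (simp add: p G)
  \<comment> \<open>Two nested recursions peel off two successors. Both have the value 0 at 0, which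
    is \<open>prod_encode (0, 0)\<close>, so the codes 0 and 1 lead to the query.\<close>
  then obtain F where F: "partial_recursive F"
    "\<And>n. F [n] = Some (rec_nat 0 (\<lambda>n r. rec_nat 0 (\<lambda>n r. prod_encode (1, Suc n)) n) n)"
    using partial_recursive_rec_nat[OF G2(1),
        of "\<lambda>n r. rec_nat 0 (\<lambda>n r. prod_encode (1, Suc n)) n"] by blast
  have "Some (code_bound_strategy xs) = F [list_encode xs]" for xs
    by (auto simp: F code_bound_strategy_def prod_encode_def split: nat.split)
  with F(1) show ?thesis
    by (auto simp: partial_computable_def)
qed

lemma code_bound_strategy_initial: "code_bound_strategy [0] = prod_encode (0, 0)"
  by (simp add: code_bound_strategy_def prod_encode_def)

text \<open>The output is the code of the history less one, which is a pair containing the code of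
  \<open>[y]\<close>; pairing bounds its components.\<close>

lemma code_bound_strategy_reply:
  obtains u where "code_bound_strategy [x, y] = prod_encode (1, u)" "y \<le> u"
proof -
  have "y < prod_encode (x, Suc (prod_encode (y, 0)))"
    using le_prod_encode_1[of y 0] le_prod_encode_2[of "Suc (prod_encode (y, 0))" x] by simp
  then show thesis
    by (intro that[of "prod_encode (x, Suc (prod_encode (y, 0)))"])
      (auto simp: code_bound_strategy_def split: nat.split)
qed

lemma Cofinite_le_DenError_0: "Cofinite \<le>\<^sub>L\<^sub>T DenError 0"
proof -
  have "arthur_nimue_win Cofinite (DenError 0) p"
    if p: "follows (\<lambda>xs. Some (code_bound_strategy xs)) (\<lambda>n _ _ _. {m. m \<ge> n}) p" for p
  proof -
    have arthur: "arthur p n = Some (code_bound_strategy (map (merlin p) [0..<Suc n]))"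
      and nimue: "nimue p n = {m. m \<ge> secret p}" for n
      using p unfolding follows_def by blast+
    \<comment> \<open>Nimue's final segment is the complement of a finite set, hence a legal secret
      input.\<close>
    have Den: "DenError 0 (0, nimue p n) = Some (nimue p n)" for n
      using DenError_0_eq_Some[OF density_zero_finite[of "{..<secret p}"]]
      by (simp add: nimue Compl_lessThan atLeast_def)
    show ?thesis
    proof (cases "merlin_legal Cofinite (DenError 0) p 0")
      case False
      then show ?thesis
        unfolding arthur_nimue_win_def reaches_def by blast
    next
      case legal0: True
      then have [simp]: "merlin p 0 = 0"
        by (auto simp: Cofinite_def dom_def split: if_splits)
      have query: "queries p 0 0"
        by (simp add: queries_def arthur code_bound_strategy_initial)
      have "reaches Cofinite (DenError 0) p 1"
        using legal0 query Den[of 0]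
        by (auto simp: reaches_def arthur_legal_query_def nimue_legal_def dom_pub_def)
      moreover have "\<exists>u V. terminates p 1 u \<and> Cofinite (merlin p 0, secret p) = Some V \<and> u \<in> V"
        if legal1: "merlin_legal Cofinite (DenError 0) p 1"
      proof -
        have "secret p \<le> merlin p 1"
          using legal1 query Den[of 0] by (auto simp: nimue queries_def prod_encode_eq)
        moreover obtain u where "code_bound_strategy [0, merlin p 1] = prod_encode (1, u)"
          "merlin p 1 \<le> u"
          using code_bound_strategy_reply .
        ultimately show ?thesis
          by (intro exI[of _ u]) (simp add: terminates_def arthur Cofinite_def)
      qed
      ultimately show ?thesis
        unfolding arthur_nimue_win_def by blast
    qed
  qed
  then show ?thesis
    unfolding LT_reducible_def using partial_computable_code_bound_strategy by blast
qed

section \<open>Avoidable sets of outputs\<close>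

text \<open>A least fixed point is the right notion because infinite plays are lost by Arthur and
  Nimue. In \<open>query\<close>, 0 is the only public input of \<open>Cofinite\<close> and
  \<open>n\<close> is Nimue's move.\<close>

inductive_set won :: "arthur_strategy \<Rightarrow> nat set \<Rightarrow> nat list set"
  for \<tau> :: arthur_strategy and B :: "nat set" where
  terminate: "\<tau> \<sigma> = Some (prod_encode (1, u)) \<Longrightarrow> u \<notin> B \<Longrightarrow> \<sigma> \<in> won \<tau> B"
| query: "\<tau> \<sigma> = Some (prod_encode (0, 0)) \<Longrightarrow> (\<And>x. x \<ge> n \<Longrightarrow> \<sigma> @ [x] \<in> won \<tau> B) \<Longrightarrow>
    \<sigma> \<in> won \<tau> B"

lemma won_queryD:
  assumes "\<sigma> \<in> won \<tau> B" "\<tau> \<sigma> = Some (prod_encode (0, 0))"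
  obtains n where "\<And>x. x \<ge> n \<Longrightarrow> \<sigma> @ [x] \<in> won \<tau> B"
  using assms by cases (auto simp: prod_encode_eq)

lemma won_antimono: "\<sigma> \<in> won \<tau> C \<Longrightarrow> B \<subseteq> C \<Longrightarrow> \<sigma> \<in> won \<tau> B"
  by (induction rule: won.induct) (auto intro: won.intros)

text \<open>Arthur's moves depend on the history only, so Nimue can follow both winning strategies
  at once by playing the larger of the two bounds; the final output then avoids both sets.\<close>

lemma won_Un:
  "\<sigma> \<in> won \<tau> B \<Longrightarrow> \<sigma> \<in> won \<tau> C \<Longrightarrow> \<sigma> \<in> won \<tau> (B \<union> C)"
proof (induction rule: won.induct)
  case (terminate \<sigma> u)
  from terminate(3,1,2) show ?case
    by cases (auto simp: prod_encode_eq intro: won.terminate)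
next
  case (query \<sigma> n)
  obtain m where m: "\<And>x. x \<ge> m \<Longrightarrow> \<sigma> @ [x] \<in> won \<tau> C"
    using won_queryD[OF query.prems query.hyps(1)] by blast
  show ?case
  proof (rule won.query[of \<tau> \<sigma>, OF query.hyps(1)])
    show "\<sigma> @ [x] \<in> won \<tau> (B \<union> C)" if "x \<ge> max m n" for x
      using query.IH[of x] m[of x] that by simp
  qed
qed

lemma won_finite:
  assumes "finite S" "\<sigma> \<in> won \<tau> {}" "\<And>u. u \<in> S \<Longrightarrow> \<sigma> \<in> won \<tau> {u}"
  shows "\<sigma> \<in> won \<tau> S"
  using assms(1,3)
proof (induction S rule: finite_induct)
  case empty
  show ?case by (rule assms(2))
next
  case (insert u S)
  then show ?case using won_Un[of \<sigma> \<tau> "{u}" S] by simp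
qed

lemma unavoidable_density_zero:
  "\<sigma> \<in> won \<tau> {} \<Longrightarrow> \<exists>B. density_zero B \<and> \<sigma> \<notin> won \<tau> B"
proof (induction rule: won.induct)
  case (terminate \<sigma> u)
  have "\<sigma> \<notin> won \<tau> {u}"
  proof
    assume "\<sigma> \<in> won \<tau> {u}"
    then show False
      by cases (use terminate in \<open>auto simp: prod_encode_eq\<close>)
  qed
  then show ?case
    using density_zero_finite[of "{u}"] by blast
next
  case (query \<sigma> n)
  show ?case
  proof (rule ccontr)
    \<comment> \<open>If every density zero set can be avoided at \<sigma>, each comes with a bound
      of Nimue's beyond which it can be avoided after every reply.\<close>
    assume "\<not> ?case"
    then have avoid: "\<exists>m. \<forall>x\<ge>m. \<sigma> @ [x] \<in> won \<tau> B" if "density_zero B" for B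
      using that won_queryD[of \<sigma> \<tau> B] query.hyps(1) by blast
    \<comment> \<open>Below \<open>n\<close> the induction hypothesis says nothing, and the empty
      set is a filler.\<close>
    have "\<exists>B. density_zero B \<and> (x \<ge> n \<longrightarrow> \<sigma> @ [x] \<notin> won \<tau> B)" for x
      using query.IH density_zero_finite[of "{}"] by (cases "x \<ge> n") auto
    then obtain B where B: "\<And>x. density_zero (B x)" "\<And>x. x \<ge> n \<Longrightarrow> \<sigma> @ [x] \<notin> won \<tau> (B x)"
      by metis
    obtain C where C: "density_zero C" "\<And>x. finite (B x - C)"
      using density_zero_pseudo_union[of B] B(1) by blast
    obtain m where m: "\<And>x. x \<ge> m \<Longrightarrow> \<sigma> @ [x] \<in> won \<tau> C"
      using avoid[OF C(1)] by blast
    \<comment> \<open>Otherwise the finite set \<open>B x - C\<close> could be avoided, hence also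
      its union with \<open>C\<close>, which contains \<open>B x\<close>.\<close>
    have "\<exists>u. \<sigma> @ [x] \<notin> won \<tau> {u}" if x: "x \<ge> max m n" for x
    proof (rule ccontr)
      assume "\<not> ?thesis"
      then have "\<sigma> @ [x] \<in> won \<tau> (B x - C)"
        using won_finite[OF C(2) query.hyps(2), of x x] x by simp
      then have "\<sigma> @ [x] \<in> won \<tau> (C \<union> (B x - C))"
        using m x by (intro won_Un) auto
      then have "\<sigma> @ [x] \<in> won \<tau> (B x)"
        by (rule won_antimono) auto
      then show False using B(2) x by simp
    qed
    then obtain u where u: "\<And>x. x \<ge> max m n \<Longrightarrow> \<sigma> @ [x] \<notin> won \<tau> {u x}"
      by metis
    define U where "U = u ` {max m n..}"
    \<comment> \<open>The set \<open>D\<close> has to catch \<open>u x\<close> for arbitrarily large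
      \<open>x\<close>, so that no bound played by Nimue escapes it.\<close>
    obtain D where D: "density_zero D" "\<And>k. \<exists>x\<ge>max k (max m n). u x \<in> D"
    proof (cases "finite U")
      case True
      show thesis
      proof (rule that[OF density_zero_finite[OF True]])
        show "\<exists>x\<ge>max k (max m n). u x \<in> U" for k
          by (rule exI[of _ "max k (max m n)"]) (simp add: U_def)
      qed
    next
      case False
      then obtain D where D: "D \<subseteq> U" "infinite D" "density_zero D"
        using infinite_density_zero_subset by blast
      show thesis
      proof (rule that[OF D(3)])
        fix k
        \<comment> \<open>Only finitely many elements of \<open>D\<close> are values of
          \<open>u\<close> at indices below \<open>k\<close>; any other element is attained at or
          beyond \<open>k\<close>.\<close>
        obtain d where d: "d \<in> D" "d \<notin> u ` {..<k}"
          using D(2) by (meson finite_imageI finite_lessThan finite_subset subsetI)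
        then obtain x where "x \<ge> max m n" "d = u x"
          using D(1) by (auto simp: U_def)
        with d show "\<exists>x\<ge>max k (max m n). u x \<in> D"
          by (intro exI[of _ x]) auto
      qed
    qed
    obtain k where k: "\<And>x. x \<ge> k \<Longrightarrow> \<sigma> @ [x] \<in> won \<tau> D"
      using avoid[OF D(1)] by blast
    obtain x where x: "x \<ge> max k (max m n)" "u x \<in> D"
      using D(2) by blast
    then have "\<sigma> @ [x] \<in> won \<tau> {u x}"
      using won_antimono[OF k, of x "{u x}"] by simp
    with u x(1) show False by simp
  qed
qed

section \<open>The winning strategy of Merlin\<close>

text \<open>The histories of Merlin's, Arthur's and Nimue's moves, where Merlin has moved once more than the
  others. He replies above Nimue's bound and, where possible, stays outside \<open>W\<close>.\<close>

primrec evading_history :: "arthur_strategy \<Rightarrow> ('l, nat) nimue_strategy \<Rightarrow> nat list set \<Rightarrow> 'l \<Rightarrow> nat \<Rightarrow>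
    nat list \<times> nat option list \<times> nat list" where
  "evading_history \<tau> \<eta> W c 0 = ([0], [], [])"
| "evading_history \<tau> \<eta> W c (Suc n) =
    (case evading_history \<tau> \<eta> W c n of (xs, as, ns) \<Rightarrow>
      let as' = as @ [\<tau> xs]; m = \<eta> c xs as' ns
      in (xs @ [SOME x. x \<ge> m \<and> xs @ [x] \<notin> W], as', ns @ [m]))"

text \<open>Nimue's strategy also reads her own and Arthur's past moves, so the three sequences are
  built together and the play consists of their last entries.\<close>

lemma evading_play:
  obtains p where "follows \<tau> \<eta> p" "secret p = c" "merlin p 0 = 0"
    "\<And>n. merlin p (Suc n) = (SOME x. x \<ge> nimue p n \<and> map (merlin p) [0..<Suc n] @ [x] \<notin> W)"
proof -
  let ?h = "evading_history \<tau> \<eta> W c"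
  define p where "p = \<lparr>secret = c, merlin = (\<lambda>n. last (fst (?h n))),
    arthur = (\<lambda>n. last (fst (snd (?h (Suc n))))), nimue = (\<lambda>n. last (snd (snd (?h (Suc n)))))\<rparr>"
  have h: "?h n = (map (merlin p) [0..<Suc n], map (arthur p) [0..<n], map (nimue p) [0..<n])" for n
  proof (induction n)
    case 0
    show ?case by (simp add: p_def)
  next
    case (Suc n)
    obtain xs as ns where eq: "?h n = (xs, as, ns)" by (cases "?h n") auto
    have "merlin p (Suc n) = last (fst (?h (Suc n)))" "arthur p n = last (fst (snd (?h (Suc n))))"
      "nimue p n = last (snd (snd (?h (Suc n))))"
      by (simp_all add: p_def del: evading_history.simps)
    with Suc eq show ?case by (simp add: Let_def)
  qed
  have step: "arthur p n = \<tau> (map (merlin p) [0..<Suc n]) \<and>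
      nimue p n = \<eta> c (map (merlin p) [0..<Suc n]) (map (arthur p) [0..<Suc n]) (map (nimue p) [0..<n]) \<and>
      merlin p (Suc n) = (SOME x. x \<ge> nimue p n \<and> map (merlin p) [0..<Suc n] @ [x] \<notin> W)" for n
    using h[of "Suc n"] h[of n] by (auto simp: Let_def)
  have secret: "secret p = c" and first: "merlin p 0 = 0"
    by (simp_all add: p_def)
  show thesis
  proof (rule that[OF _ secret first])
    show "follows \<tau> \<eta> p"
      unfolding follows_def secret using step by blast
  qed (use step in blast)
qed

lemma not_DenError_0_le_Cofinite: "\<not> DenError 0 \<le>\<^sub>L\<^sub>T Cofinite"
proof
  assume "DenError 0 \<le>\<^sub>L\<^sub>T Cofinite"
  then obtain \<tau> \<eta> where win: "\<And>p. follows \<tau> \<eta> p \<Longrightarrow> arthur_nimue_win (DenError 0) Cofinite p"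
    unfolding LT_reducible_def by blast
  \<comment> \<open>If \<open>[0]\<close> is not even in \<open>won \<tau> {}\<close>, the empty set
    serves as \<open>B\<close>.\<close>
  obtain B where B: "density_zero B" "[0] \<notin> won \<tau> B"
    using unavoidable_density_zero[of "[0]" \<tau>] density_zero_finite[of "{}"] by blast
  obtain p where p: "follows \<tau> \<eta> p" "secret p = - B" "merlin p 0 = 0"
    and merlin: "\<And>n. merlin p (Suc n) =
      (SOME x. x \<ge> nimue p n \<and> map (merlin p) [0..<Suc n] @ [x] \<notin> won \<tau> B)"
    using evading_play[of \<tau> \<eta> "- B" "won \<tau> B"] by blast
  have arthur: "arthur p n = \<tau> (map (merlin p) [0..<Suc n])" for n
    using p(1) unfolding follows_def by blast
  have start: "DenError 0 (merlin p 0, secret p) = Some (- B)"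
    using DenError_0_eq_Some[OF B(1)] p by simp
  \<comment> \<open>Merlin never breaks a rule first, and the history stays outside
    \<open>won \<tau> B\<close>.\<close>
  have inv: "merlin_legal (DenError 0) Cofinite p n \<and> map (merlin p) [0..<Suc n] \<notin> won \<tau> B"
    if "reaches (DenError 0) Cofinite p n" for n
    using that
  proof (induction n)
    case 0
    show ?case using start B(2) p by auto
  next
    case (Suc n)
    let ?\<sigma> = "map (merlin p) [0..<Suc n]"
    have lost: "?\<sigma> \<notin> won \<tau> B"
      using Suc by (auto simp: reaches_def)
    have query: "queries p n 0"
      using Suc.prems by (auto simp: reaches_def arthur_legal_query_def dom_pub_def Cofinite_def
          split: if_splits)
    \<comment> \<open>If all replies from Nimue's bound on led into \<open>won \<tau> B\<close>, the
      clause \<open>query\<close> would put the present history there too.\<close>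
    then have "\<exists>x. x \<ge> nimue p n \<and> ?\<sigma> @ [x] \<notin> won \<tau> B"
      using lost won.query[of \<tau> ?\<sigma> "nimue p n" B] by (auto simp: queries_def arthur simp del: upt_Suc)
    from someI_ex[OF this]
    have "merlin p (Suc n) \<ge> nimue p n" "?\<sigma> @ [merlin p (Suc n)] \<notin> won \<tau> B"
      by (simp_all add: merlin del: upt_Suc)
    with query show ?case
      by (auto simp: Cofinite_def)
  qed
  \<comment> \<open>As Merlin stays legal, Arthur can win only by terminating outside
    \<open>B\<close>, and then the clause \<open>terminate\<close> contradicts the
    invariant.\<close>
  from win[OF p(1)] obtain n u where "reaches (DenError 0) Cofinite p n" "terminates p n u" "u \<notin> B"
    using inv start unfolding arthur_nimue_win_def by auto
  then show False
    using inv[of n] won.terminate[of \<tau> "map (merlin p) [0..<Suc n]" u B]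
    by (simp add: terminates_def arthur del: upt_Suc)
qed

theorem mainTheorem5: "Cofinite <\<^sub>L\<^sub>T DenError 0"
  unfolding LT_strictly_reducible_def
  using Cofinite_le_DenError_0 not_DenError_0_le_Cofinite by blast

end
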